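(* There exist an integer $m_0\ge 2$ and a constant $c>0$ such that the following holds. Let $D\subset\mathbb{R}^2$ be a bounded simply connected domain with $C^2$ boundary and let $\Omega\in\mathbb{R}$ be such that $(D,\Omega)$ is a rotating-patch solution. If $D$ is non-radial and $m$-fold symmetric for some integer $m\ge m_0$, then $$\frac12-\Omega\le\frac{c}{m}.$$
   Context: Let $\mathcal{N}(x)=\frac1{2\pi}\log|x|$ be the Newtonian potential in $\mathbb{R}^2$. For a bounded domain $D\subset\mathbb{R}^2$ and $\Omega\in\mathbb{R}$, the pair $(D,\Omega)$ is called a rotating-patch solution if the function $\Psi(x)=(1_D*\mathcal{N})(x)-\frac{\Omega}{2}|x|^2$ is constant on $\partial D$ (one constant on all of $\partial D$). $D$ is $m$-fold symmetric if it is invariant under rotation about the origin by angle $2\pi/m$. $D$ is non-radial if it is not radially symmetric about the origin (for a simply connected domain: not a disk centered at the origin). *)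

theory Defs
  imports "HOL-Analysis.Analysis"
begin

text \<open>The Euclidean plane is represented by the type \<^typ>\<open>complex\<close>, with its Euclidean norm
  and Lebesgue measure \<^const>\<open>lborel\<close>.\<close>

definition planar_domain :: "complex set \<Rightarrow> bool" where
  "planar_domain D \<longleftrightarrow> open D \<and> connected D \<and> D \<noteq> {}"

text \<open>At the origin \<^term>\<open>newtonian 0 = 0\<close> since \<^term>\<open>ln 0 = (0::real)\<close>; this value is immaterial,
  as the function is only used under an integral.\<close>

definition newtonian :: "complex \<Rightarrow> real" where
  "newtonian x = 1 / (2 * pi) * ln (norm x)"

definition convolution :: "(complex \<Rightarrow> real) \<Rightarrow> (complex \<Rightarrow> real) \<Rightarrow> complex \<Rightarrow> real" where
  "convolution f g x = (\<integral>y. f y * g (x - y) \<partial>lborel)"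

definition relative_stream :: "complex set \<Rightarrow> real \<Rightarrow> complex \<Rightarrow> real" where
  "relative_stream D \<Omega> x = convolution (indicat_real D) newtonian x - \<Omega> / 2 * (norm x)\<^sup>2"

definition rotating_patch :: "complex set \<Rightarrow> real \<Rightarrow> bool" where
  "rotating_patch D \<Omega> \<longleftrightarrow>
     bounded D \<and> planar_domain D \<and> (\<exists>C. \<forall>x\<in>frontier D. relative_stream D \<Omega> x = C)"

definition rot :: "real \<Rightarrow> complex \<Rightarrow> complex" where
  "rot \<theta> z = cis \<theta> * z"

definition fold_symmetric :: "nat \<Rightarrow> complex set \<Rightarrow> bool" where
  "fold_symmetric m D \<longleftrightarrow> rot (2 * pi / real m) ` D = D"

definition radially_symmetric :: "complex set \<Rightarrow> bool" where
  "radially_symmetric D \<longleftrightarrow> (\<forall>\<theta>. rot \<theta> ` D = D)"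

definition C2_fun :: "(real \<Rightarrow> real) \<Rightarrow> bool" where
  "C2_fun g \<longleftrightarrow> (\<exists>g' g''.
     (\<forall>t. (g has_real_derivative g' t) (at t)) \<and>
     (\<forall>t. (g' has_real_derivative g'' t) (at t)) \<and>
     continuous_on UNIV g'')"

text \<open>Near each boundary point \<open>p\<close>, in Cartesian coordinates centred at \<open>p\<close> and rotated by some
  angle \<open>\<theta>\<close>, the set is the region strictly above the graph of a \<open>C\<^sup>2\<close> function. The region below
  a graph is covered by changing \<open>\<theta>\<close> by \<open>\<pi>\<close>.\<close>

definition C2_boundary :: "complex set \<Rightarrow> bool" where
  "C2_boundary D \<longleftrightarrow> (\<forall>p\<in>frontier D. \<exists>r>0. \<exists>\<theta> g. C2_fun g \<and>
     (\<forall>z\<in>ball p r. z \<in> D \<longleftrightarrow> Im (rot (- \<theta>) (z - p)) > g (Re (rot (- \<theta>) (z - p)))))"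

end

theory Submission
  imports Defs "HOL-Complex_Analysis.Complex_Analysis"
begin

text \<open>Write \<open>ln |x - y| = ln (max |x| |y|) + ln |1 - \<zeta>|\<close>, where \<open>\<zeta>\<close> is \<open>y / x\<close> or its reflection \<open>cnj (x / y)\<close>,
  whichever lies in the closed unit disc. The first term contributes a radial function to the
  stream function. Averaging the second one over the rotations by multiples of \<open>2\<pi>/m\<close> turns it into
  \<open>(1/m) ln |1 - \<zeta>\<^sup>m| \<le> (1/m) |\<zeta>|\<^sup>m\<close>, and its integral over any radial set vanishes. So if \<open>a\<close> and \<open>b\<close> are
  the extreme distances of the boundary from the origin, the non-radial part of the
  stream function is at most \<open>1/(2\<pi>m)\<close> times the integral of \<open>|\<zeta>|\<^sup>m\<close> over the annulus \<open>a \<le> |y| \<le> b\<close>;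
  this integral is at most \<open>\<pi>(b\<^sup>2 - a\<^sup>2)\<close> and also \<open>O(|x|\<^sup>2/m)\<close>.

  Since \<open>D\<close> is simply connected and contains the disc of radius \<open>a\<close>, every circle of radius \<open>r \<in> [a, b]\<close>
  meets the boundary, where the stream function is constant. On the other hand, its radial part
  grows by at least a multiple of \<open>(1/2 - \<Omega>)(r\<^sup>2 - a\<^sup>2)\<close> from radius \<open>a\<close> to \<open>r\<close>, as long as
  \<open>r\<^sup>2/a\<^sup>2 - 1 \<le> 2(1/2 - \<Omega>)\<close>. If \<open>r = b\<close> is admissible, the first bound
  gives the claim; otherwise the largest admissible \<open>r\<close> and the second bound do.\<close>

section \<open>Rotation invariance of planar Lebesgue measure and polar coordinates\<close>

text \<open>The coordinate map pulls boxes back to boxes of the same area. This moves questions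
  about rotations to \<open>real^2\<close>, where \<open>measure_orthogonal_image\<close>
  applies.\<close>

lemma lborel_complex_eq_distr:
  "(lborel :: complex measure) = distr (lborel :: (real^2) measure) borel (\<lambda>v. Complex (vec_nth v 1) (vec_nth v 2))"
proof (rule lborel_eqI)
  fix l u :: complex
  assume le: "\<And>b. b \<in> Basis \<Longrightarrow> l \<bullet> b \<le> u \<bullet> b"
  have [measurable]: "(\<lambda>v::real^2. Complex (vec_nth v 1) (vec_nth v 2)) \<in> borel_measurable borel"
    unfolding Complex_eq by measurable
  have le': "Re l \<le> Re u" "Im l \<le> Im u"
    using le[of 1] le[of \<i>] by (auto simp: Basis_complex_def)
  let ?l = "vector [Re l, Im l] :: real^2" and ?u = "vector [Re u, Im u] :: real^2"
  have pre: "(\<lambda>v::real^2. Complex (vec_nth v 1) (vec_nth v 2)) -` box l u = box ?l ?u"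
    by (auto simp: box_def Basis_complex_def Basis_vec_def inner_axis forall_2)
  have B: "(Basis :: (real^2) set) = {axis 1 1, axis 2 1}"
    by (auto simp: Basis_vec_def exhaust_2) (metis exhaust_2)
  have ne: "axis (1::2) (1::real) \<noteq> axis 2 1"
    by (simp add: axis_eq_axis)
  have "emeasure lborel (box ?l ?u) = (\<Prod>b\<in>Basis. (?u - ?l) \<bullet> b)"
    by (rule emeasure_lborel_box) (auto simp: B inner_axis le')
  also have "(\<Prod>b\<in>Basis. (?u - ?l) \<bullet> b) = (\<Prod>b\<in>Basis. (u - l) \<bullet> b)"
    using ne by (simp add: B Basis_complex_def inner_axis)
  finally show "emeasure (distr lborel borel (\<lambda>v::real^2. Complex (vec_nth v 1) (vec_nth v 2))) (box l u) =
      (\<Prod>b\<in>Basis. (u - l) \<bullet> b)"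
    by (simp add: emeasure_distr pre)
qed simp

text \<open>The preimage of a box is its image under the inverse orthogonal map, which has the same
  measure; boxes determine \<open>lborel\<close>.\<close>

lemma lborel_distr_orthogonal:
  fixes f :: "real^'n::{finite,wellorder} \<Rightarrow> real^'n::_"
  assumes f: "orthogonal_transformation f"
  shows "distr lborel borel f = lborel"
proof (rule lborel_eqI[symmetric])
  fix l u :: "real^'n::{finite,wellorder}"
  assume le: "\<And>b. b \<in> Basis \<Longrightarrow> l \<bullet> b \<le> u \<bullet> b"
  have lin: "linear f" using f by (rule orthogonal_transformation_linear)
  have fm [measurable]: "f \<in> borel_measurable borel"
    using lin by (intro borel_measurable_continuous_onI linear_continuous_on linear_conv_bounded_linear[THEN iffD1])
  obtain g where g: "orthogonal_transformation g" "\<And>x. g (f x) = x" "\<And>x. f (g x) = x"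
    using f by (metis inv_f_f orthogonal_transformation_inj orthogonal_transformation_inv
      orthogonal_transformation_surj surj_f_inv_f)
  have pre: "f -` box l u = g ` box l u"
    using g(2,3) by (auto simp: image_iff) (metis)
  have m: "measure lebesgue (g ` box l u) = measure lebesgue (box l u)"
    and lm: "g ` box l u \<in> lmeasurable"
    using measure_orthogonal_image[OF g(1)] measurable_orthogonal_image[OF g(1)] by auto
  have "f -` box l u \<in> sets borel"
    using measurable_sets[OF fm, of "box l u"] by simp
  then have "emeasure lborel (f -` box l u) = emeasure lebesgue (g ` box l u)"
    by (simp add: pre)
  also have "\<dots> = emeasure lebesgue (box l u)"
    using m lm by (metis emeasure_eq_measure2 lmeasurable_box)
  also have "\<dots> = (\<Prod>b\<in>Basis. (u - l) \<bullet> b)"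
    using le by (simp add: emeasure_lborel_box)
  finally show "emeasure (distr lborel borel f) (box l u) = (\<Prod>b\<in>Basis. (u - l) \<bullet> b)"
    by (simp add: emeasure_distr)
qed simp

text \<open>In real coordinates, multiplication by a unimodular \<open>w\<close> is the orthogonal
  map \<open>f\<close>, and the coordinate map intertwines the two.\<close>

lemma lborel_distr_rotation:
  fixes w :: complex
  assumes w: "cmod w = 1"
  shows "distr lborel borel (\<lambda>z. w * z) = lborel"
proof -
  define \<iota> :: "real^2 \<Rightarrow> complex" where "\<iota> v = Complex (vec_nth v 1) (vec_nth v 2)" for v
  define f :: "real^2 \<Rightarrow> real^2" where
    "f v = vector [Re w * vec_nth v 1 - Im w * vec_nth v 2, Re w * vec_nth v 2 + Im w * vec_nth v 1]" for v
  have [measurable]: "\<iota> \<in> borel_measurable borel"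
    unfolding \<iota>_def Complex_eq by measurable
  have lin: "linear f"
    by (rule linearI) (auto simp: f_def vec_eq_iff forall_2 algebra_simps)
  have orth: "orthogonal_transformation f"
  proof -
    have ww: "(Re w)\<^sup>2 + (Im w)\<^sup>2 = 1" using w by (simp add: cmod_def)
    have "norm (f v) = norm v" for v
    proof -
      have "(Re w * vec_nth v 1 - Im w * vec_nth v 2)\<^sup>2 + (Re w * vec_nth v 2 + Im w * vec_nth v 1)\<^sup>2
          = ((Re w)\<^sup>2 + (Im w)\<^sup>2) * ((vec_nth v 1)\<^sup>2 + (vec_nth v 2)\<^sup>2)"
        by (simp add: power2_eq_square algebra_simps)
      then show ?thesis by (simp add: norm_vec_def L2_set_def sum_2 f_def ww)
    qed
    then show ?thesis using lin by (simp add: orthogonal_transformation)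
  qed
  have [measurable]: "f \<in> borel_measurable borel"
    using lin by (intro borel_measurable_continuous_onI linear_continuous_on linear_conv_bounded_linear[THEN iffD1])
  have "(\<lambda>z. w * z) \<circ> \<iota> = \<iota> \<circ> f"
    by (auto simp: fun_eq_iff \<iota>_def f_def complex_eq_iff algebra_simps)
  then have "distr (distr lborel borel \<iota>) borel (\<lambda>z. w * z) = distr (distr lborel borel f) borel \<iota>"
    by (simp add: distr_distr)
  then show ?thesis
    using lborel_complex_eq_distr by (simp add: lborel_distr_orthogonal[OF orth] \<iota>_def[abs_def])
qed

text \<open>Polar coordinates for radial integrands. Both measures give the half-line up to
  \<open>r\<close> the area pi r^2 of a disc (0 if \<open>r\<close> is negative), and these
  half-lines form an intersection-stable generator.\<close>

lemma lborel_distr_cmod: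
  "distr (lborel :: complex measure) borel cmod = density lborel (\<lambda>u. ennreal (2 * pi * u) * indicator {0..} u)"
    (is "?M = ?N")
proof (rule measure_eqI_generator_eq[where \<Omega> = UNIV and E = "range atMost" and A = "\<lambda>i. {..real i}"])
  show "Int_stable (range (atMost :: real \<Rightarrow> _))"
    by (auto simp: Int_stable_def)
  fix X :: "real set" assume "X \<in> range atMost"
  then obtain r where X: "X = {..r}" by auto
  show "emeasure ?M X = emeasure ?N X"
  proof (cases "r \<ge> 0")
    case True
    have "emeasure ?M X = emeasure lborel (cball (0::complex) r)"
      by (auto simp: X emeasure_distr intro!: arg_cong[where f="emeasure lborel"])
    also have "\<dots> = ennreal (pi * r\<^sup>2)"
      using True by (simp add: emeasure_cball unit_ball_vol_2)
    also have "\<dots> = (\<integral>\<^sup>+u. ennreal (2 * pi * u) * indicator {0..r} u \<partial>lborel)"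
      using True by (subst nn_integral_FTC_Icc[where F = "\<lambda>u. pi * u\<^sup>2"])
        (auto intro!: derivative_eq_intros)
    also have "\<dots> = emeasure ?N X"
      by (auto simp: X emeasure_density intro!: nn_integral_cong split: split_indicator)
    finally show ?thesis .
  next
    case False
    then have "cmod -` X = {}"
      by (auto simp: X dest: order_trans[OF norm_ge_zero])
    then have "emeasure ?M X = 0"
      by (simp add: X emeasure_distr)
    moreover have "emeasure ?N X = 0"
      using False by (auto simp: X emeasure_density nn_integral_0_iff_AE split: split_indicator)
    ultimately show ?thesis by simp
  qed
next
  show "sets ?M = sigma_sets UNIV (range atMost)" "sets ?N = sigma_sets UNIV (range atMost)"
    by (simp_all add: borel_eq_atMost)
  show "(\<Union>i. {..real i}) = UNIV"
    by (auto intro: real_arch_simple)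
  fix i
  have "emeasure ?M {..real i} = emeasure lborel (cball (0::complex) (real i))"
    by (auto simp: emeasure_distr intro!: arg_cong[where f="emeasure lborel"])
  then show "emeasure ?M {..real i} \<noteq> \<infinity>"
    by (simp add: emeasure_cball)
qed auto

lemma nn_integral_cmod:
  assumes [measurable]: "f \<in> borel_measurable borel"
  shows "(\<integral>\<^sup>+z. f (cmod z) \<partial>(lborel :: complex measure)) = (\<integral>\<^sup>+u. ennreal (2 * pi * u) * indicator {0..} u * f u \<partial>lborel)"
proof -
  have "(\<integral>\<^sup>+z. f (cmod z) \<partial>(lborel :: complex measure)) = (\<integral>\<^sup>+u. f u \<partial>distr (lborel :: complex measure) borel cmod)"
    by (simp add: nn_integral_distr)
  then show ?thesis
    by (simp add: lborel_distr_cmod nn_integral_density)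
qed

section \<open>Roots of unity and the splitting of the logarithmic kernel\<close>

text \<open>As polynomials in \<open>z\<close>, both sides have degree at most \<open>m\<close> and
  agree at \<open>m + 1\<close> points: at 0 both equal 1, and at every \<open>m\<close>-th root of
  unity both vanish.\<close>

lemma prod_roots_of_unity:
  fixes z :: complex
  assumes m: "m > 0"
  shows "(\<Prod>j<m. 1 - cis (2 * pi * real j / real m) * z) = 1 - z ^ m"
proof -
  define w where "w j = cis (2 * pi * real j / real m)" for j
  have bij: "bij_betw w {..<m} {z. z ^ m = 1}"
    unfolding w_def using Complex.bij_betw_roots_unity[OF m] .
  let ?P = "\<Prod>j<m. [:1, - w j:]" and ?Q = "1 - monom 1 m :: complex poly"
  let ?R = "{z::complex. z ^ m = 1}"
  have fin: "finite ?R" and cardR: "card ?R = m"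
    using bij bij_betw_finite bij_betw_same_card by fastforce+
  have "?P = ?Q"
  proof (rule poly_eqI_degree)
    fix u assume u: "u \<in> insert 0 ?R"
    show "poly ?P u = poly ?Q u"
    proof (cases "u = 0")
      case True
      then show ?thesis using m by (simp add: poly_prod poly_monom)
    next
      case False
      with u have um: "u ^ m = 1" by simp
      then have "inverse u \<in> ?R" by (simp add: power_inverse)
      then obtain j where j: "j < m" "w j = inverse u"
        using bij by (metis bij_betw_imp_surj_on image_iff lessThan_iff)
      then have "1 - w j * u = 0" using False by simp
      then have "(\<Prod>j<m. 1 - w j * u) = 0" using j(1) by (metis finite_lessThan lessThan_iff prod_zero_iff)
      then show ?thesis by (simp add: poly_prod poly_monom um algebra_simps)
    qed
  next
    have c: "card (insert 0 ?R) = Suc m"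
      using fin cardR m by (simp add: card_insert_if power_0_left)
    have "degree ?P \<le> (\<Sum>j<m. degree [:1, - w j:])"
      using degree_prod_sum_le[of "{..<m}" "\<lambda>j. [:1, - w j:]"] by (simp add: o_def)
    also have "\<dots> \<le> (\<Sum>j<m. 1)"
      by (intro sum_mono) (simp add: degree_pCons_le)
    finally show "degree ?P < card (insert 0 ?R)" by (simp add: c)
    have "degree ?Q \<le> m"
      by (intro degree_diff_le degree_monom_le) auto
    then show "degree ?Q < card (insert 0 ?R)" by (simp add: c)
  qed
  then have "poly ?P z = poly ?Q z" by simp
  then show ?thesis by (simp add: poly_prod poly_monom w_def algebra_simps)
qed

text \<open>This is \<open>y / x\<close> if |y| \<le> |x| and \<open>cnj (x / y)\<close> if |y|
  \<ge> |x|, for nonzero \<open>x\<close>. The single formula makes measurability and compatibility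
  with rotations of \<open>y\<close> immediate.\<close>

definition zeta :: "complex \<Rightarrow> complex \<Rightarrow> complex" where
  "zeta x y = y * cnj x / of_real ((max (cmod x) (cmod y))\<^sup>2)"

lemma zeta_rotate: "cmod w = 1 \<Longrightarrow> zeta x (w * y) = w * zeta x y"
  by (simp add: zeta_def norm_mult)

lemma borel_measurable_zeta [measurable]: "zeta x \<in> borel_measurable borel"
  unfolding zeta_def by measurable

lemma norm_zeta:
  assumes "x \<noteq> 0"
  shows "cmod (zeta x y) = min (cmod x) (cmod y) / max (cmod x) (cmod y)"
  using assms
  by (auto simp: zeta_def norm_mult norm_divide norm_power power2_eq_square min_def max_def field_simps)

lemma norm_zeta_le_1: "x \<noteq> 0 \<Longrightarrow> cmod (zeta x y) \<le> 1"
  by (auto simp: norm_zeta min_def max_def divide_le_eq_1)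

lemma norm_zeta_less_1: "x \<noteq> 0 \<Longrightarrow> cmod y \<noteq> cmod x \<Longrightarrow> cmod (zeta x y) < 1"
  by (auto simp: norm_zeta min_def max_def divide_less_eq_1)

text \<open>This is the factorization |x - y| = max |x| |y| * |1 - zeta|. Outside the disc of radius
  |x|, \<open>zeta x y\<close> is a conjugate, which does not change the modulus.\<close>

lemma norm_one_minus_zeta:
  assumes x: "x \<noteq> 0"
  shows "cmod (1 - zeta x y) = cmod (x - y) / max (cmod x) (cmod y)"
proof (cases "cmod y \<le> cmod x")
  case True
  then have "max (cmod x) (cmod y) = cmod x" by simp
  moreover have "zeta x y = y / x"
    using x True complex_norm_square[of x] by (simp add: zeta_def max_absorb1 field_simps)
  moreover have "1 - y / x = (x - y) / x"
    using x by (simp add: field_simps)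
  ultimately show ?thesis by (simp add: norm_divide)
next
  case False
  then have y: "y \<noteq> 0" and mx: "max (cmod x) (cmod y) = cmod y" by auto
  have "1 - zeta x y = 1 - cnj x / cnj y"
    using y complex_norm_square[of y] by (simp add: zeta_def mx field_simps)
  also have "\<dots> = cnj ((y - x) / y)"
    using y by (simp add: field_simps)
  finally show ?thesis
    by (simp only: mx complex_mod_cnj norm_divide norm_minus_commute)
qed

text \<open>Circles are null sets. Off the circle |y| = |x| the number \<open>zeta x y\<close> lies
  in the open unit disc, so the logarithms below have nonzero arguments almost everywhere.\<close>

lemma AE_norm_neq: "AE y in (lborel :: complex measure). cmod y \<noteq> r"
proof -
  have "emeasure lebesgue (sphere (0::complex) r) = 0"
    using negligible_sphere[of 0 r] by (simp add: negligible_iff_null_sets null_sets_def)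
  then have "sphere (0::complex) r \<in> null_sets lborel"
    by (intro null_setsI) auto
  then show ?thesis
    by (rule AE_I') auto
qed

section \<open>Integrability of the logarithmic kernels\<close>

text \<open>In polar coordinates the area factor \<open>u\<close> absorbs the singularity: u |ln u|
  stays bounded on [0, R].\<close>

lemma integrable_ln_norm: "set_integrable lborel (cball 0 R) (\<lambda>y::complex. ln (cmod y))"
proof -
  let ?f = "\<lambda>u. ennreal (indicator {..R} u * \<bar>ln u\<bar>)"
  let ?C = "2 * pi * (1 + R\<^sup>2)"
  have *: "u * \<bar>ln u\<bar> \<le> 1 + R\<^sup>2" if "0 \<le> u" "u \<le> R" for u
  proof (cases "u \<le> 1")
    case True
    show ?thesis
    proof (cases "u = 0")
      case False
      then have "u > 0" using that by simp
      have "ln (1/u) \<le> 1/u - 1" using \<open>u > 0\<close> by (intro ln_le_minus_one) auto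
      then have "- ln u \<le> 1/u - 1" using \<open>u > 0\<close> by (simp add: ln_div)
      then have "u * - ln u \<le> u * (1/u - 1)" using \<open>u > 0\<close> by (intro mult_left_mono) auto
      then have "u * - ln u \<le> 1" using \<open>u > 0\<close> by (simp add: algebra_simps)
      then show ?thesis using True \<open>u > 0\<close> by (simp add: abs_if add_increasing2)
    qed (simp add: add_nonneg_nonneg)
  next
    case False
    have "u * \<bar>ln u\<bar> \<le> u * u" using False ln_bound[of u] by (intro mult_left_mono) auto
    also have "\<dots> \<le> R * R" using that by (intro mult_mono) auto
    finally show ?thesis by (simp add: power2_eq_square)
  qed
  have "(\<integral>\<^sup>+y. ennreal (norm (indicator (cball 0 R) y *\<^sub>R ln (cmod y))) \<partial>(lborel :: complex measure))
      = (\<integral>\<^sup>+y. ?f (cmod y) \<partial>(lborel :: complex measure))"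
    by (intro nn_integral_cong) (auto split: split_indicator)
  also have "\<dots> = (\<integral>\<^sup>+u. ennreal (2 * pi * u) * indicator {0..} u * ?f u \<partial>lborel)"
    by (intro nn_integral_cmod) measurable
  also have "\<dots> \<le> (\<integral>\<^sup>+u. ennreal ?C * indicator {0..R} u \<partial>lborel)"
  proof (intro nn_integral_mono)
    fix u :: real
    show "ennreal (2 * pi * u) * indicator {0..} u * ?f u \<le> ennreal ?C * indicator {0..R} u"
    proof (cases "0 \<le> u \<and> u \<le> R")
      case True
      have "2 * pi * u * \<bar>ln u\<bar> \<le> ?C"
        using * True by (simp add: mult.assoc)
      then show ?thesis using True by (auto simp: ennreal_mult[symmetric] intro!: ennreal_leI)
    qed (auto split: split_indicator)
  qed
  also have "\<dots> < \<infinity>"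
    by (subst nn_integral_cmult_indicator) (auto simp: ennreal_mult_less_top emeasure_lborel_Icc_eq)
  finally show ?thesis
    unfolding set_integrable_def
    by (intro integrableI_bounded borel_measurable_scaleR borel_measurable_indicator) auto
qed

lemma
  fixes f :: "complex \<Rightarrow> real" and w :: complex
  assumes w: "cmod w = 1" and inv: "\<And>y. w * y \<in> S \<longleftrightarrow> y \<in> S"
    and S: "S \<in> sets borel" and f [measurable]: "f \<in> borel_measurable borel"
  shows set_integral_rotate: "(LBINT y:S. f (w * y)) = (LBINT y:S. f y)"
    and set_integrable_rotate: "set_integrable lborel S (\<lambda>y. f (w * y)) \<longleftrightarrow> set_integrable lborel S f"
proof -
  note [measurable] = S
  have eq: "indicator S y *\<^sub>R f (w * y) = (\<lambda>y. indicator S y *\<^sub>R f y) (w * y)" for y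
    by (auto simp: inv split: split_indicator)
  have "(LBINT y:S. f y) = (\<integral>y. indicator S y *\<^sub>R f y \<partial>distr lborel borel (\<lambda>z. w * z))"
    by (simp add: lborel_distr_rotation[OF w] set_lebesgue_integral_def)
  also have "\<dots> = (LBINT y:S. f (w * y))"
    unfolding set_lebesgue_integral_def eq by (intro integral_distr) measurable
  finally show "(LBINT y:S. f (w * y)) = (LBINT y:S. f y)" by simp
  have "set_integrable lborel S f \<longleftrightarrow> integrable (distr lborel borel (\<lambda>z. w * z)) (\<lambda>y. indicator S y *\<^sub>R f y)"
    by (simp add: lborel_distr_rotation[OF w] set_integrable_def)
  also have "\<dots> \<longleftrightarrow> set_integrable lborel S (\<lambda>y. f (w * y))"
    unfolding set_integrable_def eq by (intro integrable_distr_eq) measurable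
  finally show "set_integrable lborel S (\<lambda>y. f (w * y)) \<longleftrightarrow> set_integrable lborel S f" by simp
qed

lemma integrable_ln_dist:
  fixes x :: complex
  assumes S: "S \<in> sets borel" and "bounded S"
  shows "set_integrable lborel S (\<lambda>y. ln (cmod (x - y)))"
proof -
  obtain R where R: "S \<subseteq> cball x R"
    using \<open>bounded S\<close> bounded_any_center[of S x] by (metis mem_cball subsetI)
  let ?f = "\<lambda>y::complex. indicator (cball 0 R) y *\<^sub>R ln (cmod y)"
  have "integrable (lborel :: complex measure) ?f"
    using integrable_ln_norm[of R] by (simp add: set_integrable_def)
  moreover from this have [measurable]: "?f \<in> borel_measurable borel"
    using borel_measurable_integrable by fastforce
  \<comment> \<open>The reflection is a rotation, by the unimodular number -1; followed by a
    translation it turns the origin-centred kernel into y -> x - y.\<close>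
  ultimately have "integrable (distr lborel borel (\<lambda>z. - 1 * z)) ?f"
    using lborel_distr_rotation[of "- 1"] by simp
  then have "integrable lborel (\<lambda>y. ?f (- 1 * y))"
    by (subst (asm) integrable_distr_eq) measurable
  then have "integrable (distr lborel borel (\<lambda>z. - x + z)) (\<lambda>y. ?f (- 1 * y))"
    by (simp only: lborel_distr_plus)
  then have "integrable lborel (\<lambda>y. ?f (- 1 * (- x + y)))"
    by (subst (asm) integrable_distr_eq) measurable
  moreover have "?f (- 1 * (- x + y)) = indicator (cball x R) y *\<^sub>R ln (cmod (x - y))" for y
    by (auto simp: dist_norm norm_minus_commute split: split_indicator)
  ultimately have "set_integrable lborel (cball x R) (\<lambda>y. ln (cmod (x - y)))"
    by (simp only: set_integrable_def)
  then show ?thesis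
    by (rule set_integrable_subset) (use R S in auto)
qed

lemma set_integrable_bounded:
  fixes f :: "complex \<Rightarrow> real"
  assumes S: "S \<in> sets borel" and bS: "bounded S"
    and [measurable]: "f \<in> borel_measurable borel" and bnd: "\<And>y. y \<in> S \<Longrightarrow> \<bar>f y\<bar> \<le> C"
  shows "set_integrable lborel S f" "\<bar>LBINT y:S. f y\<bar> \<le> C * measure lborel S"
proof -
  note [measurable] = S
  have fin: "emeasure lborel S < \<infinity>"
    using bS by (rule emeasure_bounded_finite)
  then have i: "integrable lborel (\<lambda>y. indicator S y * C)"
    by (auto simp: fin)
  show 1: "set_integrable lborel S f"
    unfolding set_integrable_def
    by (rule Bochner_Integration.integrable_bound[OF i]) (use bnd in \<open>auto split: split_indicator\<close>, fastforce)
  have "\<bar>LBINT y:S. f y\<bar> \<le> (\<integral>y. indicator S y * C \<partial>lborel)"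
    unfolding set_lebesgue_integral_def real_norm_def[symmetric]
    by (rule Bochner_Integration.integral_norm_bound_integral[OF 1[unfolded set_integrable_def] i])
      (use bnd in \<open>auto split: split_indicator\<close>)
  also have "\<dots> = C * measure lborel S" using fin by simp
  finally show "\<bar>LBINT y:S. f y\<bar> \<le> C * measure lborel S" .
qed

lemma
  fixes x :: complex
  assumes S: "S \<in> sets borel" and bS: "bounded S" and x: "x \<noteq> 0"
  shows integrable_ln_max: "set_integrable lborel S (\<lambda>y. ln (max (cmod x) (cmod y)))"
    and integrable_ln_zeta: "set_integrable lborel S (\<lambda>y. ln (cmod (1 - zeta x y)))"
    and integral_ln_dist: "(LBINT y:S. ln (cmod (x - y))) =
      (LBINT y:S. ln (max (cmod x) (cmod y))) + (LBINT y:S. ln (cmod (1 - zeta x y)))"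
proof -
  obtain R where R: "\<And>y. y \<in> S \<Longrightarrow> cmod y \<le> R"
    using bS by (auto simp: bounded_iff)
  show 1: "set_integrable lborel S (\<lambda>y. ln (max (cmod x) (cmod y)))"
  proof (rule set_integrable_bounded[OF S bS])
    fix y assume "y \<in> S"
    let ?M = "max (cmod x) (cmod y)"
    have "ln (cmod x) \<le> ln ?M" using x by (intro ln_mono) auto
    moreover have "ln ?M \<le> ?M - 1" using x by (intro ln_le_minus_one) (auto simp: less_max_iff_disj)
    moreover have "?M \<le> cmod x + \<bar>R\<bar>" using R[OF \<open>y \<in> S\<close>] norm_ge_zero[of x] by linarith
    ultimately show "\<bar>ln ?M\<bar> \<le> \<bar>ln (cmod x)\<bar> + cmod x + \<bar>R\<bar>"
      using norm_ge_zero[of x] by linarith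
  qed measurable
  note 2 = integrable_ln_dist[OF S bS, of x]
  have 3: "AE y in lborel. y \<in> S \<longrightarrow> ln (cmod (1 - zeta x y)) = ln (cmod (x - y)) - ln (max (cmod x) (cmod y))"
    using AE_norm_neq[of "cmod x"]
  proof eventually_elim
    case (elim y)
    then have "x \<noteq> y" by auto
    then have "ln (cmod (x - y) / max (cmod x) (cmod y)) = ln (cmod (x - y)) - ln (max (cmod x) (cmod y))"
      using x by (intro ln_divide_pos) (auto simp: less_max_iff_disj)
    then show ?case by (simp add: norm_one_minus_zeta[OF x])
  qed
  note [measurable] = S
  have 4: "set_integrable lborel S (\<lambda>y. ln (cmod (x - y)) - ln (max (cmod x) (cmod y)))"
    by (rule set_integral_diff(1)[OF 2 1])
  show "set_integrable lborel S (\<lambda>y. ln (cmod (1 - zeta x y)))"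
    using 4 unfolding set_integrable_def
    by (subst integrable_cong_AE[where g = "\<lambda>y. indicator S y *\<^sub>R (ln (cmod (x - y)) - ln (max (cmod x) (cmod y)))"])
      (use 3 in \<open>auto elim!: eventually_mono split: split_indicator\<close>)
  have "(LBINT y:S. ln (cmod (1 - zeta x y))) = (LBINT y:S. ln (cmod (x - y)) - ln (max (cmod x) (cmod y)))"
    unfolding set_lebesgue_integral_def using S
    by (intro integral_cong_AE) (use 3 in \<open>auto elim!: eventually_mono split: split_indicator\<close>)
  then show "(LBINT y:S. ln (cmod (x - y))) =
      (LBINT y:S. ln (max (cmod x) (cmod y))) + (LBINT y:S. ln (cmod (1 - zeta x y)))"
    using set_integral_diff(2)[OF 2 1] by simp
qed

section \<open>Averaging the logarithm over rotations\<close>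

text \<open>Rotating by an \<open>m\<close>-th root of unity does not change the integral over
  \<open>S\<close>, while the \<open>m\<close> rotated integrands add up to the logarithm of the
  product in \<open>prod_roots_of_unity\<close>. The bound \<open>g1\<close> keeps all factors
  nonzero. The function \<open>g\<close> is general so that both \<open>zeta x\<close> and its
  multiples by \<open>t < 1\<close> are covered.\<close>

lemma
  fixes g :: "complex \<Rightarrow> complex"
  assumes m: "m > 0" and S: "S \<in> sets borel"
    and inv: "\<And>y. cis (2 * pi / real m) * y \<in> S \<longleftrightarrow> y \<in> S"
    and g [measurable]: "g \<in> borel_measurable borel"
    and ginv: "\<And>w y. cmod w = 1 \<Longrightarrow> g (w * y) = w * g y"
    and g1: "AE y in lborel. cmod (g y) < 1"
    and int: "set_integrable lborel S (\<lambda>y. ln (cmod (1 - g y)))"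
  shows set_integrable_ln_power: "set_integrable lborel S (\<lambda>y. ln (cmod (1 - g y ^ m)))"
    and set_integral_ln_power:
      "(LBINT y:S. ln (cmod (1 - g y ^ m))) = real m * (LBINT y:S. ln (cmod (1 - g y)))"
proof -
  define w where "w j = cis (2 * pi * real j / real m)" for j
  have wj: "w j = cis (2 * pi / real m) ^ j" for j
    unfolding w_def Complex.DeMoivre by (rule arg_cong[where f = cis]) simp
  have nw: "cmod (w j) = 1" for j by (simp add: w_def)
  have invj: "w j * y \<in> S \<longleftrightarrow> y \<in> S" for j y
  proof (induction j arbitrary: y)
    case (Suc j)
    then show ?case using inv by (simp add: wj mult.assoc)
  qed (simp add: w_def)
  let ?f = "\<lambda>y. ln (cmod (1 - g y))"
  have f [measurable]: "?f \<in> borel_measurable borel" by measurable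
  have I: "set_integrable lborel S (\<lambda>y. ?f (w j * y))" "(LBINT y:S. ?f (w j * y)) = (LBINT y:S. ?f y)" for j
    using set_integrable_rotate[OF nw invj S f] set_integral_rotate[OF nw invj S f] int by auto
  have sumI: "set_integrable lborel S (\<lambda>y. \<Sum>j<m. ?f (w j * y))"
    unfolding set_integrable_def scaleR_sum_right
    by (intro Bochner_Integration.integrable_sum) (use I(1) in \<open>simp add: set_integrable_def\<close>)
  have sumE: "(LBINT y:S. \<Sum>j<m. ?f (w j * y)) = real m * (LBINT y:S. ?f y)"
    unfolding set_lebesgue_integral_def scaleR_sum_right
    by (subst Bochner_Integration.integral_sum)
      (use I in \<open>auto simp: set_integrable_def set_lebesgue_integral_def\<close>)
  have AE: "AE y in lborel. (\<Sum>j<m. ?f (w j * y)) = ln (cmod (1 - g y ^ m))"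
    using g1
  proof eventually_elim
    case (elim y)
    have ne: "1 - w j * g y \<noteq> 0" for j
    proof
      assume "1 - w j * g y = 0"
      then have "cmod (w j * g y) = 1" by (metis eq_iff_diff_eq_0 norm_one)
      with elim nw show False by (simp add: norm_mult)
    qed
    have "ln (cmod (1 - g y ^ m)) = ln (\<Prod>j<m. cmod (1 - w j * g y))"
      using prod_roots_of_unity[OF m, of "g y"] by (simp add: w_def prod_norm)
    also have "\<dots> = (\<Sum>j<m. ln (cmod (1 - w j * g y)))"
      using ne by (intro ln_prod) auto
    finally show ?case by (simp add: ginv nw)
  qed
  have fm [measurable]: "(\<lambda>y. \<Sum>j<m. ?f (w j * y)) \<in> borel_measurable borel" by measurable
  have fm' [measurable]: "(\<lambda>y. ln (cmod (1 - g y ^ m))) \<in> borel_measurable borel" by measurable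
  note [measurable] = S
  have AE': "AE y in lborel. indicator S y *\<^sub>R (\<Sum>j<m. ?f (w j * y)) = indicator S y *\<^sub>R ln (cmod (1 - g y ^ m))"
    using AE by eventually_elim simp
  show "set_integrable lborel S (\<lambda>y. ln (cmod (1 - g y ^ m)))"
    using sumI unfolding set_integrable_def
    by (subst (asm) integrable_cong_AE[OF _ _ AE']) measurable
  show "(LBINT y:S. ln (cmod (1 - g y ^ m))) = real m * (LBINT y:S. ?f y)"
    using sumE unfolding set_lebesgue_integral_def
    by (subst (asm) integral_cong_AE[OF _ _ AE']) measurable
qed

text \<open>The modulus lies between 1 - t and 1 + t, and 1 + t \<le> 1/(1 - t), so one bound serves
  for both signs.\<close>

lemma abs_ln_one_minus_le:
  fixes z :: complex
  assumes "cmod z \<le> t" "t < 1"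
  shows "\<bar>ln (cmod (1 - z))\<bar> \<le> - ln (1 - t)"
proof -
  have l: "1 - t \<le> cmod (1 - z)" and u: "cmod (1 - z) \<le> 1 + t"
    using norm_triangle_ineq2[of 1 z] norm_triangle_ineq4[of 1 z] assms by auto
  have t: "t \<ge> 0" using assms(1) norm_ge_zero[of z] by linarith
  have "(1 + t) * (1 - t) \<le> 1" by (simp add: algebra_simps)
  then have "1 + t \<le> inverse (1 - t)" using assms by (simp add: field_simps)
  then have "cmod (1 - z) \<le> inverse (1 - t)" using u by simp
  then have "ln (cmod (1 - z)) \<le> ln (inverse (1 - t))"
    using l assms by (intro ln_mono) auto
  moreover have "ln (1 - t) \<le> ln (cmod (1 - z))"
    using l assms by (intro ln_mono) auto
  ultimately show ?thesis using assms by (simp add: ln_inverse)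
qed

text \<open>The bound on the integral of \<open>ln |1 - (t\<zeta>)\<^sup>n|\<close> does not depend on \<open>n\<close>, while this integral is \<open>n\<close>
  times the one for \<open>n = 1\<close>.\<close>

lemma set_integral_ln_scaled_zeta:
  fixes x :: complex
  assumes S: "S \<in> sets borel" and bS: "bounded S" and x: "x \<noteq> 0"
    and rad: "\<And>w y. cmod w = 1 \<Longrightarrow> w * y \<in> S \<longleftrightarrow> y \<in> S"
    and t: "0 \<le> t" "t < 1"
  shows "(LBINT y:S. ln (cmod (1 - of_real t * zeta x y))) = 0"
proof -
  let ?J = "LBINT y:S. ln (cmod (1 - of_real t * zeta x y))"
  let ?K = "- ln (1 - t) * measure lborel S"
  have le: "cmod (of_real t * zeta x y) \<le> t" for y
    using norm_zeta_le_1[OF x, of y] t by (simp add: norm_mult mult_left_le)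
  have "real n * \<bar>?J\<bar> \<le> ?K" if n: "n > 0" for n
  proof -
    have "set_integrable lborel S (\<lambda>y. ln (cmod (1 - of_real t * zeta x y)))"
      by (rule set_integrable_bounded[OF S bS _ abs_ln_one_minus_le[OF le t(2)]]) measurable
    then have "(LBINT y:S. ln (cmod (1 - (of_real t * zeta x y) ^ n))) = real n * ?J"
      using le t by (intro set_integral_ln_power[OF n S]) (auto simp: rad zeta_rotate intro!: AE_I2 le_less_trans[OF le])
    moreover have "cmod ((of_real t * zeta x y) ^ n) \<le> t" for y
    proof -
      have "cmod (of_real t * zeta x y) ^ n \<le> cmod (of_real t * zeta x y) ^ 1"
        using n le[of y] t by (intro power_decreasing) auto
      then show ?thesis using le[of y] by (simp add: norm_power)
    qed
    then have "\<bar>LBINT y:S. ln (cmod (1 - (of_real t * zeta x y) ^ n))\<bar> \<le> ?K"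
      using t(2) by (intro set_integrable_bounded(2)[OF S bS _ abs_ln_one_minus_le]) measurable
    ultimately show ?thesis by (simp add: abs_mult)
  qed
  note bound = this
  have "?J = 0"
  proof (rule ccontr)
    assume "?J \<noteq> 0"
    then obtain n where n: "\<bar>?K\<bar> < real n * \<bar>?J\<bar>"
      using ex_less_of_nat_mult[of "\<bar>?J\<bar>" "\<bar>?K\<bar>"] by auto
    then have "n > 0" by (cases n) auto
    from bound[OF this] n show False by linarith
  qed
  then show ?thesis by simp
qed

text \<open>The integral vanishes with \<open>zeta\<close> scaled by any \<open>t < 1\<close>, where
  the logarithm is bounded; dominated convergence as t -> 1 reaches the singular case.\<close>

lemma set_integral_ln_zeta_radial:
  fixes x :: complex
  assumes S: "S \<in> sets borel" and bS: "bounded S" and x: "x \<noteq> 0"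
    and rad: "\<And>w y. cmod w = 1 \<Longrightarrow> w * y \<in> S \<longleftrightarrow> y \<in> S"
  shows "(LBINT y:S. ln (cmod (1 - zeta x y))) = 0"
proof -
  note [measurable] = S
  define t :: "nat \<Rightarrow> real" where "t k = 1 - inverse (real (Suc k))" for k
  have t: "0 \<le> t k" "t k < 1" for k by (auto simp: t_def field_simps)
  have tlim: "t \<longlonglongrightarrow> 1"
    unfolding t_def using tendsto_diff[OF tendsto_const LIMSEQ_inverse_real_of_nat] by simp
  let ?f = "\<lambda>k y. ln (cmod (1 - of_real (t k) * zeta x y))"
  let ?g = "\<lambda>y. ln (cmod (1 - zeta x y))"
  \<comment> \<open>This makes \<open>ln 2 + |ln |1 - \<zeta>||\<close> a dominating function for the limit \<open>t \<rightarrow> 1\<close>.\<close>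
  have half: "cmod (1 - z) \<le> 2 * cmod (1 - of_real s * z)" if "cmod z \<le> 1" "0 \<le> s" "s \<le> 1" for s z
  proof -
    \<comment> \<open>The correction term has modulus at most 1 - s, which is itself a lower bound
      for |1 - s z|; hence the factor 2.\<close>
    have "1 - z = (1 - of_real s * z) - of_real (1 - s) * z" by (simp add: algebra_simps)
    then have "cmod (1 - z) \<le> cmod (1 - of_real s * z) + cmod (of_real (1 - s) * z)"
      by (metis norm_triangle_ineq4)
    moreover have "cmod (of_real (1 - s) * z) \<le> 1 - s"
      using that by (simp only: norm_mult norm_of_real) (simp add: mult_left_le)
    moreover have "1 - s \<le> cmod (1 - of_real s * z)"
    proof -
      have "cmod (of_real s * z) \<le> s" using that by (simp add: norm_mult mult_left_le)
      then show ?thesis using norm_triangle_ineq2[of 1 "of_real s * z"] by simp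
    qed
    ultimately show ?thesis by simp
  qed
  have AE1: "AE y in lborel. cmod (zeta x y) < 1"
    using AE_norm_neq[of "cmod x"] by eventually_elim (rule norm_zeta_less_1[OF x])
  have "(\<lambda>k. \<integral>y. indicator S y *\<^sub>R ?f k y \<partial>lborel) \<longlonglongrightarrow> (\<integral>y. indicator S y *\<^sub>R ?g y \<partial>lborel)"
  proof (rule integral_dominated_convergence[where w = "\<lambda>y. indicator S y *\<^sub>R (ln 2 + \<bar>?g y\<bar>)"])
    have "set_integrable lborel S (\<lambda>y. ln 2 + \<bar>?g y\<bar>)"
      using set_integrable_bounded(1)[OF S bS, of "\<lambda>_. ln 2" "ln 2"]
        set_integrable_abs[OF integrable_ln_zeta[OF S bS x]]
      by (intro set_integral_add(1)) auto
    then show "integrable lborel (\<lambda>y. indicator S y *\<^sub>R (ln 2 + \<bar>?g y\<bar>))"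
      by (simp add: set_integrable_def)
    show "AE y in lborel. (\<lambda>k. indicator S y *\<^sub>R ?f k y) \<longlonglongrightarrow> indicator S y *\<^sub>R ?g y"
      using AE1
    proof eventually_elim
      case (elim y)
      then have "cmod (1 - 1 * zeta x y) \<noteq> 0" by auto
      moreover have "(\<lambda>k. cmod (1 - of_real (t k) * zeta x y)) \<longlonglongrightarrow> cmod (1 - of_real 1 * zeta x y)"
        by (intro tendsto_intros tlim)
      ultimately have "(\<lambda>k. ?f k y) \<longlonglongrightarrow> ln (cmod (1 - of_real 1 * zeta x y))"
        by (intro tendsto_ln) auto
      then show ?case by (intro tendsto_scaleR tendsto_const) simp
    qed
    fix k
    show "AE y in lborel. norm (indicator S y *\<^sub>R ?f k y) \<le> indicator S y *\<^sub>R (ln 2 + \<bar>?g y\<bar>)"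
      using AE1
    proof eventually_elim
      case (elim y)
      let ?z = "zeta x y"
      have pos: "cmod (1 - ?z) > 0" using elim by auto
      have h: "cmod (1 - ?z) \<le> 2 * cmod (1 - of_real (t k) * ?z)"
        using elim t[of k] by (intro half) auto
      then have pos': "cmod (1 - of_real (t k) * ?z) > 0" using pos by linarith
      have "cmod (of_real (t k) * ?z) \<le> 1"
        using elim t[of k] by (simp add: norm_mult mult_le_one)
      then have "cmod (1 - of_real (t k) * ?z) \<le> 2"
        using norm_triangle_ineq4[of 1 "of_real (t k) * ?z"] by simp
      then have "?f k y \<le> ln 2" using pos' by (intro ln_mono) auto
      moreover have "?g y \<le> ln (2 * cmod (1 - of_real (t k) * ?z))"
        using h pos by (intro ln_mono) auto
      then have "?g y \<le> ln 2 + ?f k y" using pos' by (simp add: ln_mult)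
      ultimately have "\<bar>?f k y\<bar> \<le> ln 2 + \<bar>?g y\<bar>"
        using abs_ge_self[of "?g y"] abs_ge_minus_self[of "?g y"] ln_gt_zero[of 2] by linarith
      then show ?case by (simp split: split_indicator)
    qed
  qed measurable
  moreover have "(\<integral>y. indicator S y *\<^sub>R ?f k y \<partial>lborel) = 0" for k
    using set_integral_ln_scaled_zeta[OF S bS x rad t] by (simp add: set_lebesgue_integral_def)
  ultimately have "(\<integral>y. indicator S y *\<^sub>R ?g y \<partial>lborel) = 0"
    by (simp add: LIMSEQ_const_iff)
  then show ?thesis by (simp add: set_lebesgue_integral_def)
qed

section \<open>Bounds for the non-radial part of the potential\<close>

lemma set_integrable_norm_zeta_power:
  assumes "S \<in> sets borel" "bounded S" "x \<noteq> 0"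
  shows "set_integrable lborel S (\<lambda>y. cmod (zeta x y) ^ m)"
  by (rule set_integrable_bounded[OF assms(1,2), where C = 1])
    (use norm_zeta_le_1[OF assms(3)] in \<open>auto simp: power_le_one\<close>)

text \<open>Averaging replaces \<open>zeta\<close> by its \<open>m\<close>-th power; then ln v \<le>
  v - 1 and the triangle inequality |1 - z| \<le> 1 + |z| suffice.\<close>

lemma set_integral_ln_zeta_le:
  assumes m: "m > 0" and S: "S \<in> sets borel" and bS: "bounded S" and x: "x \<noteq> 0"
    and inv: "\<And>y. cis (2 * pi / real m) * y \<in> S \<longleftrightarrow> y \<in> S"
  shows "real m * (LBINT y:S. ln (cmod (1 - zeta x y))) \<le> (LBINT y:S. cmod (zeta x y) ^ m)"
proof -
  have AE1: "AE y in lborel. cmod (zeta x y) < 1"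
    using AE_norm_neq[of "cmod x"] by eventually_elim (rule norm_zeta_less_1[OF x])
  note P = m S inv borel_measurable_zeta zeta_rotate AE1 integrable_ln_zeta[OF S bS x]
  have "real m * (LBINT y:S. ln (cmod (1 - zeta x y))) = (LBINT y:S. ln (cmod (1 - zeta x y ^ m)))"
    by (rule set_integral_ln_power[OF P, symmetric])
  also have "\<dots> \<le> (LBINT y:S. cmod (zeta x y) ^ m)"
  proof (rule set_integral_mono[OF set_integrable_ln_power[OF P] set_integrable_norm_zeta_power[OF S bS x]])
    fix y
    show "ln (cmod (1 - zeta x y ^ m)) \<le> cmod (zeta x y) ^ m"
    \<comment> \<open>In the degenerate case the left side is \<open>ln 0 = 0\<close>, and the right
      side is nonnegative.\<close>
    proof (cases "cmod (1 - zeta x y ^ m) = 0")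
      case False
      then have "ln (cmod (1 - zeta x y ^ m)) \<le> cmod (1 - zeta x y ^ m) - 1"
        by (intro ln_le_minus_one) simp
      also have "\<dots> \<le> cmod (zeta x y) ^ m"
        using norm_triangle_ineq4[of 1 "zeta x y ^ m"] by (simp add: norm_power)
      finally show ?thesis .
    qed simp
  qed
  finally show ?thesis .
qed

text \<open>The integral over the radial set \<open>A\<close> vanishes, so the one over
  \<open>S\<close> is minus the one over \<open>A - S\<close>. Both sets have the
  \<open>m\<close>-fold symmetry, so the upper bound for the complement is a lower bound for
  \<open>S\<close>; the logarithm is never estimated from below.\<close>

lemma abs_set_integral_ln_zeta_le:
  assumes m: "m > 0" and A: "A \<in> sets borel" and bA: "bounded A" and x: "x \<noteq> 0"
    and rad: "\<And>w y. cmod w = 1 \<Longrightarrow> w * y \<in> A \<longleftrightarrow> y \<in> A"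
    and S: "S \<in> sets borel" and SA: "S \<subseteq> A"
    and inv: "\<And>y. cis (2 * pi / real m) * y \<in> S \<longleftrightarrow> y \<in> S"
  shows "real m * \<bar>LBINT y:S. ln (cmod (1 - zeta x y))\<bar> \<le> (LBINT y:A. cmod (zeta x y) ^ m)"
proof -
  let ?L = "\<lambda>y. ln (cmod (1 - zeta x y))" and ?P = "\<lambda>y. cmod (zeta x y) ^ m"
  have bound: "real m * (LBINT y:T. ?L y) \<le> (LBINT y:A. ?P y)"
    if T: "T \<in> sets borel" "T \<subseteq> A" and Tinv: "\<And>y. cis (2 * pi / real m) * y \<in> T \<longleftrightarrow> y \<in> T" for T
  proof -
    have bT: "bounded T" using bA T(2) bounded_subset by blast
    have "real m * (LBINT y:T. ?L y) \<le> (LBINT y:T. ?P y)"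
      by (rule set_integral_ln_zeta_le[OF m T(1) bT x Tinv])
    also have "\<dots> \<le> (LBINT y:A. ?P y)"
      unfolding set_lebesgue_integral_def
      by (intro integral_mono set_integrable_norm_zeta_power[OF T(1) bT x, unfolded set_integrable_def]
          set_integrable_norm_zeta_power[OF A bA x, unfolded set_integrable_def])
        (use T(2) in \<open>auto split: split_indicator\<close>)
    finally show ?thesis .
  qed
  have bS: "bounded S" and bAS: "bounded (A - S)" using bA SA bounded_subset by blast+
  have "(LBINT y:A. ?L y) = (LBINT y:S \<union> (A - S). ?L y)"
    using SA by (simp add: Un_absorb1)
  also have "\<dots> = (LBINT y:S. ?L y) + (LBINT y:A - S. ?L y)"
    using A S by (intro set_integral_Un integrable_ln_zeta bS bAS x) auto
  finally have "(LBINT y:S. ?L y) = - (LBINT y:A - S. ?L y)"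
    using set_integral_ln_zeta_radial[OF A bA x rad] by simp
  moreover have "real m * (LBINT y:S. ?L y) \<le> (LBINT y:A. ?P y)"
    by (rule bound[OF S SA inv])
  moreover have "real m * (LBINT y:A - S. ?L y) \<le> (LBINT y:A. ?P y)"
    by (rule bound) (use A S inv rad in auto)
  ultimately show ?thesis by (simp add: abs_if)
qed

lemma set_integral_norm_zeta_power_le_measure:
  assumes "S \<in> sets borel" "bounded S" "x \<noteq> 0"
  shows "(LBINT y:S. cmod (zeta x y) ^ m) \<le> measure lborel S"
  using set_integrable_bounded(2)[OF assms(1,2), of "\<lambda>y. cmod (zeta x y) ^ m" 1] norm_zeta_le_1[OF assms(3)]
  by (auto simp: power_le_one)

text \<open>With r = |x|, the whole plane contributes 2 pi r^2/(m + 2) from inside the circle of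
  radius \<open>r\<close> and 2 pi r^2/(m - 2) from outside. The bound is therefore independent of
  the size of \<open>S\<close>.\<close>

lemma set_integral_norm_zeta_power_le:
  assumes S: "S \<in> sets borel" and bS: "bounded S" and x: "x \<noteq> 0" and m: "m \<ge> 4"
  shows "(LBINT y:S. cmod (zeta x y) ^ m) \<le> 6 * pi * (cmod x)\<^sup>2 / m"
proof -
  note [measurable] = S
  define r where "r = cmod x"
  have r: "r > 0" using x by (simp add: r_def)
  \<comment> \<open>The outer integrand decays like u^(1 - m), so its antiderivative is a multiple
    of u^(-k).\<close>
  define k where "k = m - 2"
  have k: "m = k + 2" "k \<ge> 2" using m by (auto simp: k_def)
  let ?f = "\<lambda>u. ennreal ((min r u / max r u) ^ m)"
  let ?f1 = "\<lambda>u. 2 * pi * u * (u / r) ^ m" and ?f2 = "\<lambda>u. 2 * pi * u * (r / u) ^ m"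
  have "ennreal (LBINT y:S. cmod (zeta x y) ^ m) = (\<integral>\<^sup>+y. ennreal (indicator S y *\<^sub>R cmod (zeta x y) ^ m) \<partial>lborel)"
    unfolding set_lebesgue_integral_def
    using set_integrable_norm_zeta_power[OF S bS x]
    by (subst nn_integral_eq_integral) (auto simp: set_integrable_def)
  also have "\<dots> \<le> (\<integral>\<^sup>+y. ?f (cmod y) \<partial>(lborel :: complex measure))"
    by (intro nn_integral_mono) (auto simp: norm_zeta[OF x] r_def split: split_indicator)
  also have "\<dots> = (\<integral>\<^sup>+u. ennreal (2 * pi * u) * indicator {0..} u * ?f u \<partial>lborel)"
    by (intro nn_integral_cmod) measurable
  also have "\<dots> \<le> (\<integral>\<^sup>+u. ennreal (?f1 u) * indicator {0..r} u + ennreal (?f2 u) * indicator {r..} u \<partial>lborel)"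
  proof (intro nn_integral_mono)
    fix u :: real
    show "ennreal (2 * pi * u) * indicator {0..} u * ?f u
        \<le> ennreal (?f1 u) * indicator {0..r} u + ennreal (?f2 u) * indicator {r..} u"
    proof (cases "u < 0")
      case False
      then have "ennreal (2 * pi * u) * ?f u = ennreal (if u \<le> r then ?f1 u else ?f2 u)"
        using r by (subst ennreal_mult[symmetric]) (auto simp: min_def max_def)
      then show ?thesis
        using False by (cases "u \<le> r") (auto split: split_indicator)
    qed simp
  qed
  also have "\<dots> = (\<integral>\<^sup>+u. ennreal (?f1 u) * indicator {0..r} u \<partial>lborel)
      + (\<integral>\<^sup>+u. ennreal (?f2 u) * indicator {r..} u \<partial>lborel)"
    by (intro nn_integral_add) auto
  also have "(\<integral>\<^sup>+u. ennreal (?f1 u) * indicator {0..r} u \<partial>lborel) = ennreal (2 * pi * r\<^sup>2 / (m + 2))"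
  proof -
    define d where "d = real m + 2"
    have d: "d > 0" and dm: "real (m + 2) = d" by (simp_all add: d_def)
    let ?F = "\<lambda>u. 2 * pi * u ^ (m + 2) / (r ^ m * d)"
    have "(\<integral>\<^sup>+u. ennreal (?f1 u) * indicator {0..r} u \<partial>lborel) = ?F r - ?F 0"
    proof (rule nn_integral_FTC_Icc[where F = ?F])
      fix u assume u: "u \<in> {0..r}"
      have "((\<lambda>u. u ^ (m + 2)) has_real_derivative d * u ^ (m + 1)) (at u)"
        by (rule DERIV_cong[OF DERIV_pow]) (simp add: d_def)
      then have "(?F has_real_derivative (2 * pi * (d * u ^ (m + 1))) / (r ^ m * d)) (at u)"
        by (intro DERIV_cdivide DERIV_cmult)
      moreover have "(2 * pi * (d * u ^ (m + 1))) / (r ^ m * d) = ?f1 u"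
        using r d by (simp add: power_divide)
      ultimately show "(?F has_real_derivative ?f1 u) (at u)" by simp
      show "0 \<le> ?f1 u" using u r by simp
    qed (use r in auto)
    also have "?F r - ?F 0 = 2 * pi * r\<^sup>2 / (m + 2)"
      unfolding dm using r d by (simp add: power_add power2_eq_square)
    finally show ?thesis .
  qed
  also have "(\<integral>\<^sup>+u. ennreal (?f2 u) * indicator {r..} u \<partial>lborel) = ennreal (2 * pi * r\<^sup>2 / k)"
  proof -
    let ?F = "\<lambda>u. - (2 * pi * r ^ m / k) * inverse (u ^ k)"
    have "(\<integral>\<^sup>+u. ennreal (?f2 u) * indicator {r..} u \<partial>lborel) = 0 - ?F r"
    proof (rule nn_integral_FTC_atLeast[where F = ?F])
      fix u assume u: "r \<le> u"
      then have u0: "u > 0" using r by simp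
      have "((\<lambda>u. inverse (u ^ k)) has_real_derivative - (real k * u ^ (k - 1) * inverse ((u ^ k)\<^sup>2))) (at u)"
        using u0 by (auto intro!: derivative_eq_intros simp: power2_eq_square)
      then have "(?F has_real_derivative - (2 * pi * r ^ m / k) * - (real k * u ^ (k - 1) * inverse ((u ^ k)\<^sup>2))) (at u)"
        by (rule DERIV_cmult)
      moreover have "- (2 * pi * r ^ m / k) * - (real k * u ^ (k - 1) * inverse ((u ^ k)\<^sup>2)) = ?f2 u"
      proof -
        obtain j where j: "k = Suc j" using k by (cases k) auto
        have "- (2 * pi * r ^ m / k) * - (k * u ^ (k - 1) * inverse ((u ^ k)\<^sup>2)) = 2 * pi * r ^ m * (u ^ j / (u ^ Suc j)\<^sup>2)"
          using k by (simp add: j divide_inverse del: power_Suc)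
        also have "u ^ j / (u ^ Suc j)\<^sup>2 = u / u ^ m"
          using u0 by (simp add: k j power2_eq_square)
        finally show ?thesis
          by (simp add: power_divide)
      qed
      ultimately show "(?F has_real_derivative ?f2 u) (at u)" by simp
      show "0 \<le> ?f2 u" using u0 r by simp
    next
      have "filterlim (\<lambda>u::real. u ^ k) at_top at_top"
        using k by (intro filterlim_pow_at_top filterlim_ident) auto
      then have "((\<lambda>u::real. inverse (u ^ k)) \<longlongrightarrow> 0) at_top"
        by (rule tendsto_inverse_0_at_top)
      from tendsto_mult_left[OF this, of "- (2 * pi * r ^ m / k)"]
      show "(?F \<longlongrightarrow> 0) at_top" by (simp only: mult_zero_right)
    qed measurable
    also have "0 - ?F r = 2 * pi * r\<^sup>2 / k"
      using r by (simp add: k power2_eq_square)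
    finally show ?thesis .
  qed
  also have "ennreal (2 * pi * r\<^sup>2 / (m + 2)) + ennreal (2 * pi * r\<^sup>2 / k) = ennreal (2 * pi * r\<^sup>2 / (m + 2) + 2 * pi * r\<^sup>2 / k)"
    by (intro ennreal_plus[symmetric]) auto
  also have "\<dots> \<le> ennreal (6 * pi * r\<^sup>2 / m)"
  proof (rule ennreal_leI)
    \<comment> \<open>Here m \<ge> 4 enters through k = m - 2 \<ge> m/2.\<close>
    have "2 * pi * r\<^sup>2 / (m + 2) + 2 * pi * r\<^sup>2 / k \<le> 2 * pi * r\<^sup>2 / m + 2 * pi * r\<^sup>2 / (real m / 2)"
      using k m r by (intro add_mono divide_left_mono) auto
    also have "\<dots> = 6 * pi * r\<^sup>2 / m"
      by (simp add: add_divide_distrib[symmetric])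
    finally show "2 * pi * r\<^sup>2 / (m + 2) + 2 * pi * r\<^sup>2 / k \<le> 6 * pi * r\<^sup>2 / m" .
  qed
  finally show ?thesis
    using r by (simp add: r_def)
qed

section \<open>The stream function at two boundary points\<close>

lemma relative_stream_eq:
  "relative_stream D \<Omega> x = (LBINT y:D. ln (cmod (x - y))) / (2 * pi) - \<Omega> / 2 * (cmod x)\<^sup>2"
proof -
  have "convolution (indicat_real D) newtonian x = (\<integral>y. (indicator D y *\<^sub>R ln (cmod (x - y))) / (2 * pi) \<partial>lborel)"
    unfolding convolution_def newtonian_def by (intro Bochner_Integration.integral_cong) auto
  then show ?thesis
    by (simp add: relative_stream_def set_lebesgue_integral_def)
qed

text \<open>The difference of the integrands is nonnegative, and on the disc of radius |x|, of area
  pi |x|^2, it is the constant ln(|x'|/|x|).\<close>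

lemma set_integral_ln_max_diff_ge:
  assumes D: "D \<in> sets borel" and bD: "bounded D" and ball: "ball 0 (cmod x) \<subseteq> D"
    and x: "x \<noteq> 0" and le: "cmod x \<le> cmod x'"
  shows "(LBINT y:D. ln (max (cmod x') (cmod y))) - (LBINT y:D. ln (max (cmod x) (cmod y)))
    \<ge> pi * (cmod x)\<^sup>2 * ln (cmod x' / cmod x)"
proof -
  have x': "x' \<noteq> 0" using x le by auto
  note i = integrable_ln_max[OF D bD x] and i' = integrable_ln_max[OF D bD x']
  have fin: "emeasure lborel (ball (0::complex) (cmod x)) < \<infinity>"
    by (rule emeasure_bounded_finite) simp
  have "pi * (cmod x)\<^sup>2 * ln (cmod x' / cmod x) = (\<integral>y. indicator (ball 0 (cmod x)) y * ln (cmod x' / cmod x) \<partial>(lborel :: complex measure))"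
    using content_ball[of "cmod x" "0::complex"] by (simp add: unit_ball_vol_2)
  also have "\<dots> \<le> (\<integral>y. indicator D y *\<^sub>R (ln (max (cmod x') (cmod y)) - ln (max (cmod x) (cmod y))) \<partial>lborel)"
  proof (rule integral_mono)
    show "integrable lborel (\<lambda>y. indicator D y *\<^sub>R (ln (max (cmod x') (cmod y)) - ln (max (cmod x) (cmod y))))"
      using set_integral_diff(1)[OF i' i] by (simp add: set_integrable_def)
    show "integrable (lborel :: complex measure) (\<lambda>y. indicator (ball 0 (cmod x)) y * ln (cmod x' / cmod x))"
      using fin by auto
    fix y
    have "ln (max (cmod x) (cmod y)) \<le> ln (max (cmod x') (cmod y))"
      using x le by (intro ln_mono) (auto simp: less_max_iff_disj)
    moreover have "ln (max (cmod x') (cmod y)) - ln (max (cmod x) (cmod y)) = ln (cmod x' / cmod x)" if "y \<in> ball 0 (cmod x)"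
      using that x x' le by (simp add: ln_div max_def)
    ultimately show "indicator (ball 0 (cmod x)) y * ln (cmod x' / cmod x)
        \<le> indicator D y *\<^sub>R (ln (max (cmod x') (cmod y)) - ln (max (cmod x) (cmod y)))"
      using ball by (auto split: split_indicator)
  qed
  also have "\<dots> = (LBINT y:D. ln (max (cmod x') (cmod y))) - (LBINT y:D. ln (max (cmod x) (cmod y)))"
    using set_integral_diff(2)[OF i' i] by (simp add: set_lebesgue_integral_def)
  finally show ?thesis .
qed

text \<open>The inner disc is radial and contributes nothing to the non-radial part, so only the
  annulus matters and the error at each point is at most M/m. Equal stream values force the radial
  growth to be at most the sum of the two errors. The bound \<open>M\<close> is left open because
  two different ones are inserted later.\<close>

lemma stream_comparison:
  fixes D :: "complex set"
  assumes D: "D \<in> sets borel" and m: "m > 0"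
    and inv: "\<And>y. cis (2 * pi / real m) * y \<in> D \<longleftrightarrow> y \<in> D"
    and ball: "ball 0 (cmod x) \<subseteq> D" and cball: "D \<subseteq> cball 0 b"
    and x: "x \<noteq> 0" and le: "cmod x \<le> cmod x'"
    and eq: "relative_stream D \<Omega> x = relative_stream D \<Omega> x'"
    and M: "\<And>z. z \<in> {x, x'} \<Longrightarrow> (LBINT y:cball 0 b - ball 0 (cmod x). cmod (zeta z y) ^ m) \<le> M"
  shows "(cmod x)\<^sup>2 * ln (cmod x' / cmod x) - \<Omega> * ((cmod x')\<^sup>2 - (cmod x)\<^sup>2) \<le> 2 * M / (pi * m)"
proof -
  have bD: "bounded D" using cball bounded_subset bounded_cball by blast
  let ?B = "ball (0::complex) (cmod x)" and ?A = "cball 0 b - ball (0::complex) (cmod x)"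
  let ?L = "\<lambda>z y. ln (cmod (1 - zeta z y))"
  have bA: "bounded ?A" using bounded_subset[OF bounded_cball] by blast
  have E: "\<bar>LBINT y:D. ?L z y\<bar> \<le> M / m" if z: "z \<in> {x, x'}" for z
  proof -
    have z0: "z \<noteq> 0" using z x le by auto
    have "(LBINT y:D. ?L z y) = (LBINT y:?B \<union> (D - ?B). ?L z y)"
      using ball by (simp add: Un_absorb1)
    also have "\<dots> = (LBINT y:?B. ?L z y) + (LBINT y:D - ?B. ?L z y)"
      using D bD by (intro set_integral_Un integrable_ln_zeta z0) (auto intro: bounded_subset)
    also have "(LBINT y:?B. ?L z y) = 0"
      by (rule set_integral_ln_zeta_radial) (use z0 in \<open>auto simp: norm_mult\<close>)
    finally have "(LBINT y:D. ?L z y) = (LBINT y:D - ?B. ?L z y)" by simp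
    moreover have "real m * \<bar>LBINT y:D - ?B. ?L z y\<bar> \<le> (LBINT y:?A. cmod (zeta z y) ^ m)"
      by (rule abs_set_integral_ln_zeta_le[OF m _ bA z0]) (use D cball inv in \<open>auto simp: norm_mult\<close>)
    ultimately show ?thesis
      using M[OF z] m by (simp add: field_simps)
  qed
  have x': "x' \<noteq> 0" using x le by auto
  let ?G = "\<lambda>z. LBINT y:D. ln (max (cmod z) (cmod y))"
  have "(?G x' + (LBINT y:D. ?L x' y)) / (2 * pi) - \<Omega> / 2 * (cmod x')\<^sup>2
      = (?G x + (LBINT y:D. ?L x y)) / (2 * pi) - \<Omega> / 2 * (cmod x)\<^sup>2"
    using eq integral_ln_dist[OF D bD x] integral_ln_dist[OF D bD x'] by (simp add: relative_stream_eq)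
  then have "(?G x' - ?G x) - pi * \<Omega> * ((cmod x')\<^sup>2 - (cmod x)\<^sup>2) = (LBINT y:D. ?L x y) - (LBINT y:D. ?L x' y)"
    by (simp add: field_simps)
  then have "pi * (cmod x)\<^sup>2 * ln (cmod x' / cmod x) - pi * \<Omega> * ((cmod x')\<^sup>2 - (cmod x)\<^sup>2) \<le> 2 * (M / m)"
    using set_integral_ln_max_diff_ge[OF D bD ball x le] E[of x] E[of x'] by simp
  then have "pi * ((cmod x)\<^sup>2 * ln (cmod x' / cmod x) - \<Omega> * ((cmod x')\<^sup>2 - (cmod x)\<^sup>2)) \<le> 2 * M / m"
    by (simp add: algebra_simps)
  then show ?thesis
    using m by (simp add: field_simps)
qed

section \<open>Topology of simply connected symmetric domains\<close>

text \<open>A branch \<open>g\<close> of the logarithm on \<open>D\<close> would satisfy \<open>g (w z) = g z + 2\<pi>\<i> (k + 1/m)\<close> with a constant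
  integer \<open>k\<close>; \<open>m\<close> rotations return to \<open>z\<close>, so \<open>m k + 1 = 0\<close>.\<close>

lemma zero_in_simply_connected_symmetric:
  fixes D :: "complex set"
  assumes D: "open D" "connected D" "D \<noteq> {}" "simply_connected D"
    and m: "m \<ge> 2" and inv: "\<And>y. cis (2 * pi / real m) * y \<in> D \<longleftrightarrow> y \<in> D"
  shows "0 \<in> D"
proof (rule ccontr)
  assume "0 \<notin> D"
  then have "continuous_on D (\<lambda>z. z) \<and> (\<forall>z\<in>D. z \<noteq> 0)" by auto
  then obtain g where g: "continuous_on D g" "\<And>z. z \<in> D \<Longrightarrow> z = exp (g z)"
    using D(4) simply_connected_eq_continuous_log[OF D(1)] by metis
  define w where "w = cis (2 * pi / real m)"
  have invw: "w * y \<in> D \<longleftrightarrow> y \<in> D" for y using inv by (simp add: w_def)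
  have wexp: "w = exp (\<i> * of_real (2 * pi / real m))" by (simp add: w_def cis_conv_exp)
  \<comment> \<open>\<open>h\<close> counts the full turns by which the increment of
    \<open>g\<close> under the rotation differs from the expected 2 pi i/m.\<close>
  define h where "h z = (g (w * z) - g z - \<i> * of_real (2 * pi / real m)) / (2 * of_real pi * \<i>)" for z
  have hint: "h z \<in> \<int>" if z: "z \<in> D" for z
  proof -
    have "exp (g (w * z) - g z - \<i> * of_real (2 * pi / real m)) = (w * z) / z / w"
      using g(2)[OF z] g(2)[of "w * z"] invw z by (simp add: exp_diff wexp)
    also have "\<dots> = 1"
      using z \<open>0 \<notin> D\<close> by (auto simp: w_def)
    finally obtain n :: int where "Re (g (w * z) - g z - \<i> * of_real (2 * pi / real m)) = 0"
        "Im (g (w * z) - g z - \<i> * of_real (2 * pi / real m)) = of_int (2 * n) * pi"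
      unfolding exp_eq_1 by blast
    then have "g (w * z) - g z - \<i> * of_real (2 * pi / real m) = of_int (2 * n) * of_real pi * \<i>"
      by (simp only: complex_eq_iff) simp
    then have "h z = of_int n" by (simp add: h_def)
    then show ?thesis by simp
  qed
  have "continuous_on D (\<lambda>z. g (w * z))"
    by (rule continuous_on_compose2[OF g(1)]) (auto intro!: continuous_intros simp: invw)
  then have hc: "continuous_on D h"
    unfolding h_def by (intro continuous_intros g(1)) auto
  \<comment> \<open>Distinct integers are at distance at least 1, so a continuous integer-valued
    function on a connected set is constant.\<close>
  have "h constant_on D"
  proof (rule continuous_discrete_range_constant[OF D(2) hc])
    fix x assume x: "x \<in> D"
    have "1 \<le> cmod (h y - h x)" if "y \<in> D" "h y \<noteq> h x" for y
    proof -
      have "h y - h x \<in> \<int>" using hint x that by simp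
      then obtain n where n: "h y - h x = of_int n" by (auto elim: Ints_cases)
      then have "n \<noteq> 0" using that by auto
      then show ?thesis using n by (simp add: norm_of_int)
    qed
    then show "\<exists>e>0. \<forall>y. y \<in> D \<and> h y \<noteq> h x \<longrightarrow> e \<le> norm (h y - h x)"
      by (intro exI[of _ 1]) auto
  qed
  moreover obtain z0 where z0: "z0 \<in> D" using D(3) by auto
  moreover obtain k where k: "h z0 = of_int k" using hint[OF z0] by (auto elim: Ints_cases)
  ultimately have hk: "h z = of_int k" if "z \<in> D" for z
    using that by (metis constant_on_def)
  define c :: complex where "c = 2 * of_real pi * \<i> * (of_int k + 1 / of_nat m)"
  have step: "g (w * z) = g z + c" if "z \<in> D" for z
    using hk[OF that] m by (simp add: c_def h_def field_simps)
  have pow: "w ^ n * z0 \<in> D \<and> g (w ^ n * z0) = g z0 + of_nat n * c" for n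
  proof (induction n)
    case (Suc n)
    then show ?case using step[of "w ^ n * z0"] invw[of "w ^ n * z0"] by (simp add: mult.assoc algebra_simps)
  qed (use z0 in simp)
  have "w ^ m = 1"
    using m by (simp add: w_def Complex.DeMoivre)
  with pow[of m] m have "c = 0" by simp
  then have "of_int k + 1 / of_nat m = (0 :: complex)" by (simp add: c_def)
  then have "(of_int (int m * k + 1) :: complex) = 0" using m by (simp add: field_simps)
  then have "int m * k = - 1" by (simp only: of_int_eq_0_iff)
  then have "int m dvd 1" by (metis dvd_minus_iff dvd_triv_left)
  then show False using m by simp
qed

lemma connected_sphere_complex: "connected (sphere (0::complex) r)"
  by (rule connected_sphere) simp

text \<open>The circle of radius \<open>r\<close> is connected, so it meets the frontier once it
  meets both \<open>D\<close> and its complement. It meets \<open>D\<close> because \<open>D\<close>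
  is connected, contains 0 and comes arbitrarily close to \<open>q\<close>. If it lay inside
  \<open>D\<close>, it would trap the complement component of \<open>p\<close>, which is unbounded
  by simple connectedness.\<close>

lemma simply_connected_frontier_sphere:
  fixes D :: "complex set"
  assumes D: "open D" "connected D" "simply_connected D" "bounded D" "0 \<in> D"
    and p: "p \<in> frontier D" and q: "q \<in> frontier D" and r: "cmod p \<le> r" "r \<le> cmod q"
  obtains z where "z \<in> frontier D" "cmod z = r"
proof (cases "r = cmod p \<or> r = cmod q")
  case True
  then show ?thesis using that p q by auto
next
  case False
  then have r: "cmod p < r" "r < cmod q" using assms by auto
  have pD: "p \<notin> D" using p D(1) by (simp add: frontier_def interior_open)
  have "sphere 0 r \<inter> frontier D \<noteq> {}"
  proof (rule connected_Int_frontier[OF connected_sphere_complex])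
    have "q \<in> closure D" using q by (simp add: frontier_def)
    then obtain q' where q': "q' \<in> D" "dist q' q < cmod q - r"
      using r by (metis closure_approachable diff_gt_0_iff_gt)
    have "cmod q \<le> cmod q' + dist q' q"
      by (metis dist_norm dist_commute norm_triangle_sub)
    with q' have "r < cmod q'" by linarith
    moreover have "connected (cmod ` D)"
      by (intro connected_continuous_image D(2) continuous_intros)
    moreover have "0 \<le> r" using r norm_ge_zero[of p] by linarith
    ultimately have "r \<in> cmod ` D"
      using D(5) q'(1) connectedD_interval[of "cmod ` D" 0 "cmod q'" r] by (force intro: image_eqI[of _ _ 0])
    then show "sphere 0 r \<inter> D \<noteq> {}" by auto
    show "sphere 0 r - D \<noteq> {}"
    proof
      assume "sphere 0 r - D = {}"
      then have s: "sphere 0 r \<subseteq> D" by auto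
      let ?C = "connected_component_set (- D) p"
      have "?C \<in> components (- D)" using pD by (simp add: componentsI)
      then have "\<not> bounded ?C"
        using D(3) simply_connected_eq_unbounded_complement_components[OF D(1)] by blast
      then obtain c where c: "c \<in> ?C" "cmod c > r"
        by (meson bounded_iff not_le)
      have "connected (cmod ` ?C)"
        by (intro connected_continuous_image connected_connected_component continuous_intros)
      moreover have "p \<in> ?C" using pD by simp
      ultimately have "r \<in> cmod ` ?C"
        using c r connectedD_interval[of "cmod ` ?C" "cmod p" "cmod c" r] by auto
      then obtain y where "y \<in> ?C" "cmod y = r" by auto
      then have "y \<in> - D" using connected_component_subset by blast
      with s \<open>cmod y = r\<close> show False by auto
    qed
  qed
  then obtain z where "z \<in> frontier D" "z \<in> sphere 0 r" by blast
  then show ?thesis using that by simp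
qed

text \<open>Take \<open>p\<close> and \<open>q\<close> nearest to and farthest from the origin on
  the compact frontier. The disc inside \<open>p\<close> and the exterior beyond \<open>q\<close>
  are connected and miss the frontier; the disc contains 0, and the exterior is not contained in the
  bounded set \<open>D\<close>.\<close>

lemma frontier_extremal_radii:
  fixes D :: "complex set"
  assumes D: "open D" "bounded D" "0 \<in> D"
  obtains p q where "p \<in> frontier D" "q \<in> frontier D" "p \<noteq> 0"
    "ball 0 (cmod p) \<subseteq> D" "D \<subseteq> cball 0 (cmod q)" "cmod p \<le> cmod q"
proof -
  have ne: "frontier D \<noteq> {}"
    using D not_bounded_UNIV frontier_eq_empty by blast
  have comp: "compact (frontier D)" using D(2) by (rule compact_frontier_bounded)
  have cont: "continuous_on (frontier D) cmod" by (intro continuous_intros)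
  obtain p where p: "p \<in> frontier D" "\<And>y. y \<in> frontier D \<Longrightarrow> cmod p \<le> cmod y"
    using continuous_attains_inf[OF comp ne cont] by blast
  obtain q where q: "q \<in> frontier D" "\<And>y. y \<in> frontier D \<Longrightarrow> cmod y \<le> cmod q"
    using continuous_attains_sup[OF comp ne cont] by blast
  have "frontier D \<inter> D = {}" using D(1) by (simp add: frontier_disjoint_eq)
  then have p0: "p \<noteq> 0" using p(1) D(3) by auto
  have "ball 0 (cmod p) \<subseteq> D"
  proof (rule ccontr)
    assume "\<not> ball 0 (cmod p) \<subseteq> D"
    moreover have "0 \<in> ball 0 (cmod p) \<inter> D" using p0 D(3) by simp
    ultimately have "ball 0 (cmod p) \<inter> frontier D \<noteq> {}"
      by (intro connected_Int_frontier connected_ball) blast+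
    then show False using p(2) by force
  qed
  moreover have "D \<subseteq> cball 0 (cmod q)"
  proof (rule ccontr)
    assume *: "\<not> D \<subseteq> cball 0 (cmod q)"
    have "connected (- cball (0::complex) (cmod q))"
      by (intro connected_complement_bounded_convex) auto
    moreover have "- cball 0 (cmod q) - D \<noteq> {}"
    proof
      assume "- cball 0 (cmod q) - D = {}"
      then have "UNIV \<subseteq> D \<union> cball 0 (cmod q)" by auto
      then show False using D(2) by (metis bounded_Un bounded_cball bounded_subset not_bounded_UNIV)
    qed
    ultimately have "- cball 0 (cmod q) \<inter> frontier D \<noteq> {}"
      using * by (intro connected_Int_frontier) auto
    then show False using q(2) by force
  qed
  ultimately show ?thesis using that p q p0 by blast
qed

section \<open>Elementary estimates for the radial growth\<close>

lemma ln_ge_quadratic: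
  assumes "(1::real) \<le> s"
  shows "(s - 1) - (s - 1)\<^sup>2 / 2 \<le> ln s"
proof -
  let ?f = "\<lambda>s::real. ln s - ((s - 1) - (s - 1)\<^sup>2 / 2)"
  have "?f 1 \<le> ?f s"
  proof (rule DERIV_nonneg_imp_nondecreasing[OF assms])
    fix u :: real assume u: "1 \<le> u" "u \<le> s"
    have "(?f has_real_derivative (1 / u - (1 - (u - 1)))) (at u)"
      using u by (auto intro!: derivative_eq_intros simp: field_simps)
    moreover have "1 / u - (1 - (u - 1)) = (u - 1)\<^sup>2 / u"
      using u by (simp add: field_simps power2_eq_square)
    ultimately show "\<exists>y. (?f has_real_derivative y) (at u) \<and> 0 \<le> y"
      using u by auto
  qed
  then show ?thesis by simp
qed

text \<open>With s = (r/a)^2 the right side is at least a^2 times (1/2 - \<Omega>)(s - 1) - (s -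
  1)^2/4, by \<open>ln_ge_quadratic\<close>. The hypothesis says s - 1 \<le> 2\<mu>, so the
  quadratic loss is at most half of \<mu>(s - 1).\<close>

lemma stream_gap_lower_bound:
  assumes a: "0 < (a::real)" and le: "a \<le> r" and \<mu>: "\<mu> \<le> 1 / 2 - \<Omega>" and s: "r\<^sup>2 - a\<^sup>2 \<le> 2 * \<mu> * a\<^sup>2"
  shows "\<mu> * (r\<^sup>2 - a\<^sup>2) / 2 \<le> a\<^sup>2 * ln (r / a) - \<Omega> * (r\<^sup>2 - a\<^sup>2)"
proof -
  define s where "s = (r / a)\<^sup>2"
  have s1: "1 \<le> s" using a le by (simp add: s_def)
  have r2: "r\<^sup>2 = a\<^sup>2 * s" using a by (simp add: s_def power_divide)
  have ls: "ln s = 2 * ln (r / a)" using a le by (simp add: s_def ln_realpow)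
  have "s - 1 \<le> 2 * \<mu>"
  proof (rule mult_left_le_imp_le)
    show "a\<^sup>2 * (s - 1) \<le> a\<^sup>2 * (2 * \<mu>)" using s by (simp add: r2 algebra_simps)
  qed (use a in simp)
  then have "(s - 1) * (s - 1) \<le> 2 * \<mu> * (s - 1)" using s1 by (intro mult_right_mono) auto
  then have q: "(s - 1)\<^sup>2 / 4 \<le> \<mu> * (s - 1) / 2" by (simp add: power2_eq_square)
  have "\<mu> * (s - 1) \<le> (1 / 2 - \<Omega>) * (s - 1)" using \<mu> s1 by (intro mult_right_mono) auto
  then have "\<mu> * (s - 1) / 2 \<le> ln (r / a) - \<Omega> * (s - 1)"
  proof -
    have "\<mu> * X / 2 \<le> L - \<Omega> * X"
      if "\<mu> * X \<le> (1 / 2 - \<Omega>) * X" "X - Q / 2 \<le> 2 * L" "Q / 4 \<le> \<mu> * X / 2" for X Q L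
      using that unfolding left_diff_distrib by linarith
    from this[OF \<open>\<mu> * (s - 1) \<le> _\<close> _ q] show ?thesis using ln_ge_quadratic[OF s1] ls by simp
  qed
  then have "a\<^sup>2 * (\<mu> * (s - 1) / 2) \<le> a\<^sup>2 * (ln (r / a) - \<Omega> * (s - 1))"
    by (intro mult_left_mono) auto
  then show ?thesis by (simp add: r2 algebra_simps)
qed

lemma measure_annulus:
  assumes "0 \<le> a" "a \<le> b"
  shows "measure lborel (cball 0 b - ball (0::complex) a) = pi * (b\<^sup>2 - a\<^sup>2)"
proof -
  have "emeasure lborel (cball (0::complex) b) < \<infinity>"
    by (rule emeasure_bounded_finite) simp
  then have "measure lborel (cball 0 b - ball (0::complex) a) = measure lborel (cball (0::complex) b) - measure lborel (ball (0::complex) a)"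
    using assms by (intro measure_Diff) auto
  then show ?thesis
    using assms by (simp add: content_cball content_ball unit_ball_vol_2 algebra_simps)
qed

text \<open>An open set inside the closed disc lies in its interior. In contrapositive form, this
  makes the two extreme boundary radii of a non-radial domain distinct.\<close>

lemma radially_symmetric_between_balls:
  assumes "open D" "ball 0 a \<subseteq> D" "D \<subseteq> cball 0 a"
  shows "radially_symmetric D"
proof -
  have "D \<subseteq> interior (cball 0 a)" using assms interior_maximal by blast
  then have D: "D = ball 0 a" using assms(2) by simp
  have "rot \<theta> ` D = D" for \<theta>
  proof -
    have "y \<in> rot \<theta> ` D" if "y \<in> D" for y
      using that by (intro image_eqI[of _ _ "cis (- \<theta>) * y"]) (auto simp: D rot_def norm_mult mult.assoc[symmetric] cis_mult)
    then show ?thesis by (auto simp: D rot_def norm_mult)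
  qed
  then show ?thesis by (simp add: radially_symmetric_def)
qed

lemma fold_symmetric_iff:
  assumes "fold_symmetric m D"
  shows "cis (2 * pi / real m) * y \<in> D \<longleftrightarrow> y \<in> D"
proof -
  let ?f = "\<lambda>z. cis (2 * pi / real m) * z"
  have D: "?f ` D = D"
    using assms by (simp add: fold_symmetric_def rot_def[abs_def])
  show ?thesis
  proof
    assume "?f y \<in> D"
    then have "?f y \<in> ?f ` D" by (simp only: D)
    then show "y \<in> D" by auto
  next
    assume "y \<in> D"
    then have "?f y \<in> ?f ` D" by (rule imageI)
    then show "?f y \<in> D" by (simp only: D)
  qed
qed

section \<open>Explicit constants and the two cases for the outer radius\<close>

theorem theorem1p3:
  "\<exists>(m\<^sub>0::nat) (c::real). m\<^sub>0 \<ge> 2 \<and> c > 0 \<and>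
     (\<forall>(D::complex set) (\<Omega>::real) (m::nat).
        bounded D \<and> planar_domain D \<and> simply_connected D \<and> C2_boundary D \<and>
        rotating_patch D \<Omega> \<and> \<not> radially_symmetric D \<and>
        m \<ge> m\<^sub>0 \<and> fold_symmetric m D
        \<longrightarrow> 1 / 2 - \<Omega> \<le> c / real m)"
proof -
  have bound: "1 / 2 - \<Omega> \<le> 5 / real m"
    if bD: "bounded D" and dom: "planar_domain D" and sc: "simply_connected D"
      and patch: "rotating_patch D \<Omega>" and nonrad: "\<not> radially_symmetric D"
      and m: "m \<ge> 11" and fs: "fold_symmetric m D" for D \<Omega> m
  proof (rule ccontr)
    assume contra: "\<not> 1 / 2 - \<Omega> \<le> 5 / real m"
    \<comment> \<open>The cap 1/2 keeps the largest admissible radius comparable to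
      \<open>a\<close>. Since 11/2 > 5, the cap does not destroy \<mu> m > 5; this is where m \<ge>
      11 is used.\<close>
    define \<mu> where "\<mu> = min (1 / 2 - \<Omega>) (1 / 2)"
    have m0: "real m \<ge> 11" using m by simp
    have \<mu>m: "\<mu> * m > 5"
    proof -
      have "(1 / 2 - \<Omega>) * m > 5" using contra m0 by (simp add: field_simps)
      then show ?thesis using m0 by (auto simp: \<mu>_def min_def)
    qed
    have \<mu>pos: "\<mu> > 0"
    proof (rule ccontr)
      assume "\<not> \<mu> > 0"
      then have "\<mu> * m \<le> 0" by (simp add: mult_nonpos_nonneg)
      with \<mu>m show False by simp
    qed
    have D: "open D" "connected D" "D \<noteq> {}" using dom by (auto simp: planar_domain_def)
    note inv = fold_symmetric_iff[OF fs]
    have D0: "0 \<in> D"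
      by (rule zero_in_simply_connected_symmetric[OF D sc _ inv]) (use m in simp)
    obtain p q where pq: "p \<in> frontier D" "q \<in> frontier D" "p \<noteq> 0"
      "ball 0 (cmod p) \<subseteq> D" "D \<subseteq> cball 0 (cmod q)" "cmod p \<le> cmod q"
      using frontier_extremal_radii[OF D(1) bD D0] .
    define a b where "a = cmod p" and "b = cmod q"
    have a: "a > 0" using pq(3) by (simp add: a_def)
    have ab: "a < b"
      using nonrad radially_symmetric_between_balls[OF D(1) pq(4)] pq(5,6)
      by (auto simp: a_def b_def less_le)
    let ?A = "cball 0 b - ball (0::complex) a"
    have bA: "bounded ?A" using bounded_subset[OF bounded_cball] by blast
    \<comment> \<open>This combines the upper bound from equal stream values with the lower bound on
      radial growth, for any boundary point of admissible radius.\<close>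
    have gap: "\<mu> * ((cmod z)\<^sup>2 - a\<^sup>2) * (pi * m) \<le> 4 * M"
      if z: "z \<in> frontier D" and sm: "(cmod z)\<^sup>2 - a\<^sup>2 \<le> 2 * \<mu> * a\<^sup>2" and az: "a \<le> cmod z"
        and M: "\<And>x. x \<in> {p, z} \<Longrightarrow> (LBINT y:?A. cmod (zeta x y) ^ m) \<le> M" for z M
    proof -
      have "relative_stream D \<Omega> p = relative_stream D \<Omega> z"
        using patch pq(1) z by (auto simp: rotating_patch_def)
      then have "a\<^sup>2 * ln (cmod z / a) - \<Omega> * ((cmod z)\<^sup>2 - a\<^sup>2) \<le> 2 * M / (pi * m)"
        unfolding a_def
        by (intro stream_comparison[OF _ _ inv pq(4) _ pq(3) _ _ M[unfolded a_def]])
          (use D(1) m pq(5) az in \<open>auto simp: a_def b_def\<close>)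
      moreover have "\<mu> * ((cmod z)\<^sup>2 - a\<^sup>2) / 2 \<le> a\<^sup>2 * ln (cmod z / a) - \<Omega> * ((cmod z)\<^sup>2 - a\<^sup>2)"
        by (rule stream_gap_lower_bound[OF a az _ sm]) (simp add: \<mu>_def)
      ultimately have "\<mu> * ((cmod z)\<^sup>2 - a\<^sup>2) / 2 \<le> 2 * M / (pi * m)" by linarith
      then show ?thesis using m by (simp add: field_simps)
    qed
    show False
    proof (cases "b\<^sup>2 - a\<^sup>2 \<le> 2 * \<mu> * a\<^sup>2")
      case True
      \<comment> \<open>The farthest point is admissible. Taking the area of the annulus for
        \<open>M\<close> makes b^2 - a^2 cancel, leaving \<mu> m \<le> 4.\<close>
      have "\<mu> * ((cmod q)\<^sup>2 - a\<^sup>2) * (pi * m) \<le> 4 * (pi * (b\<^sup>2 - a\<^sup>2))"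
      proof (rule gap[OF pq(2)])
        fix x assume "x \<in> {p, q}"
        then have "x \<noteq> 0" using a ab by (auto simp: a_def b_def)
        then show "(LBINT y:?A. cmod (zeta x y) ^ m) \<le> pi * (b\<^sup>2 - a\<^sup>2)"
          using set_integral_norm_zeta_power_le_measure[OF _ bA] a ab by (simp add: measure_annulus)
      qed (use True ab in \<open>auto simp: b_def\<close>)
      then have "(\<mu> * m) * (pi * (b\<^sup>2 - a\<^sup>2)) \<le> 4 * (pi * (b\<^sup>2 - a\<^sup>2))"
        by (simp add: b_def mult_ac)
      moreover have "pi * (b\<^sup>2 - a\<^sup>2) > 0" using a ab by (simp add: power_strict_mono)
      ultimately have "\<mu> * m \<le> 4" by (rule mult_right_le_imp_le)
      with \<mu>m show False by simp
    next
      case False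
      \<comment> \<open>This is the largest admissible radius: r^2 - a^2 equals 2\<mu> a^2.\<close>
      define r where "r = a * sqrt (1 + 2 * \<mu>)"
      have r2: "r\<^sup>2 = a\<^sup>2 * (1 + 2 * \<mu>)" using \<mu>pos by (simp add: r_def power_mult_distrib)
      have "a \<le> r" using a \<mu>pos by (simp add: r_def)
      moreover have "r \<le> b"
      proof (rule power2_le_imp_le)
        show "r\<^sup>2 \<le> b\<^sup>2" using False by (simp add: r2 algebra_simps)
      qed (use a ab in simp)
      ultimately obtain z where z: "z \<in> frontier D" "cmod z = r"
        using simply_connected_frontier_sphere[OF D(1,2) sc bD D0 pq(1,2)] by (auto simp: a_def b_def)
      have r2le: "r\<^sup>2 \<le> 2 * a\<^sup>2"
      proof -
        have "\<mu> \<le> 1 / 2" unfolding \<mu>_def by (rule min.cobounded2)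
        then have "1 + 2 * \<mu> \<le> 2" by simp
        then have "a\<^sup>2 * (1 + 2 * \<mu>) \<le> a\<^sup>2 * 2" by (intro mult_left_mono) auto
        then show ?thesis by (simp add: r2 mult.commute)
      qed
      \<comment> \<open>Now \<open>M\<close> comes from the bound 6 pi |x|^2/m with |x|^2 \<le> 2
        a^2. As r^2 - a^2 is itself a multiple of \<mu> a^2, the outcome is (\<mu> m)^2 \<le> 24,
        just below 5^2.\<close>
      have "\<mu> * ((cmod z)\<^sup>2 - a\<^sup>2) * (pi * m) \<le> 4 * (12 * pi * a\<^sup>2 / m)"
      proof (rule gap[OF z(1)])
        fix x assume "x \<in> {p, z}"
        then have x: "x \<noteq> 0" "(cmod x)\<^sup>2 \<le> 2 * a\<^sup>2"
          using a \<open>a \<le> r\<close> z(2) r2le by (auto simp: a_def)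
        have "(LBINT y:?A. cmod (zeta x y) ^ m) \<le> 6 * pi * (cmod x)\<^sup>2 / m"
          using m by (intro set_integral_norm_zeta_power_le bA x) auto
        also have "\<dots> \<le> 6 * pi * (2 * a\<^sup>2) / m"
          using x(2) by (intro divide_right_mono mult_left_mono) auto
        finally show "(LBINT y:?A. cmod (zeta x y) ^ m) \<le> 12 * pi * a\<^sup>2 / m" by simp
      qed (use z(2) \<open>a \<le> r\<close> in \<open>auto simp: r2 algebra_simps\<close>)
      moreover have "(cmod z)\<^sup>2 - a\<^sup>2 = 2 * \<mu> * a\<^sup>2" by (simp add: z(2) r2 algebra_simps)
      ultimately have "\<mu> * (2 * \<mu> * a\<^sup>2) * (pi * m) \<le> 4 * (12 * pi * a\<^sup>2 / m)" by simp
      then have "\<mu> * (2 * \<mu> * a\<^sup>2) * (pi * m) * m \<le> 4 * (12 * pi * a\<^sup>2 / m) * m"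
        by (rule mult_right_mono) simp
      then have "(\<mu> * m)\<^sup>2 * (2 * pi * a\<^sup>2) \<le> 24 * (2 * pi * a\<^sup>2)"
        using m0 by (simp add: power2_eq_square mult_ac)
      then have "(\<mu> * m)\<^sup>2 \<le> 24" by (rule mult_right_le_imp_le) (use a in simp)
      moreover have "5\<^sup>2 < (\<mu> * m)\<^sup>2" using \<mu>m by (intro power_strict_mono) auto
      ultimately show False by simp
    qed
  qed
  show ?thesis
    by (rule exI[of _ 11], rule exI[of _ 5]) (use bound in auto)
qed

end
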